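(* Let $X$ be a Hausdorff locally convex topological vector space. Let $T=\{T_t\}_{t\in\mathbb{R}^+}$ be a $C_0$-sequentially equicontinuous semigroup on $X$ with infinitesimal generator $A$, and assume that for every $x\in X$ and every $\lambda>0$ the generalized Riemann integral $\int_0^{+\infty}e^{-\lambda t}T_tx\,dt$ exists in $X$. Let $S=\{S_t\}_{t\in\mathbb{R}^+}$ be a $C_0$-sequentially equicontinuous semigroup on $X$ with infinitesimal generator $A_S=A$. Then $S=T$.
   Context: $\mathbb{R}^+=[0,+\infty)$. A family of functions $\{f_\iota:X\to X\}_{\iota\in\mathcal{I}}$ is sequentially equicontinuous if for every $x\in X$, every sequence $x_n\to x$ in $X$ and every neighborhood $U$ of $0$ in $X$ there is $\overline n$ such that $f_\iota(x_n)\in f_\iota(x)+U$ for all $\iota\in\mathcal{I}$ and $n\ge\overline n$. A $C_0$-sequentially equicontinuous semigroup on $X$ is a family $T=\{T_t:X\to X\}_{t\in\mathbb{R}^+}$ of linear operators (not assumed continuous) such that: (i) $T_0=I$ and $T_{t+s}=T_tT_s$ for all $t,s\ge0$; (ii) $\lim_{t\to0^+}T_tx=x$ for every $x\in X$; (iii) $T$ is a sequentially equicontinuous family. The infinitesimal generator $A$ of $T$ has domain $\mathcal{D}(A)=\{x\in X:\ \lim_{h\to0^+}\frac{T_hx-x}{h}\text{ exists in }X\}$ and $Ax=\lim_{h\to0^+}\frac{T_hx-x}{h}$ for $x\in\mathcal{D}(A)$. Equality of generators includes equality of domains. The generalized Riemann integral $\int_0^{+\infty}e^{-\lambda t}T_tx\,dt$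 exists in $X$ if for every $a\ge0$ the Riemann integral $\int_0^ae^{-\lambda t}T_tx\,dt$ exists in $X$ and its limit as $a\to+\infty$ exists in $X$. *)

theory Defs
  imports "HOL-Analysis.Analysis"
begin

(* The scalars are the reals. A complex space is in particular a real one, with the same
   topology and the same convex sets, so this covers both choices of scalar field. *)
class real_topological_vector_space = real_vector + topological_ab_group_add +
  assumes tendsto_scaleR_Pair:
    "LIM p (nhds c \<times>\<^sub>F nhds x). fst p *\<^sub>R snd p :> nhds (c *\<^sub>R x)"

(* The third conjunct is the definition of "convex V", which a class specification cannot
   mention by name because of its sort constraint. *)
class hausdorff_locally_convex_space = real_topological_vector_space + t2_space +
  assumes convex_neighbourhood_base:
    "open U \<Longrightarrow> 0 \<in> U \<Longrightarrow> \<exists>V. open V \<and> 0 \<in> V \<and>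
      (\<forall>x\<in>V. \<forall>y\<in>V. \<forall>u\<ge>0. \<forall>v\<ge>0. u + v = 1 \<longrightarrow> u *\<^sub>R x + v *\<^sub>R y \<in> V) \<and> V \<subseteq> U"

definition sequentially_equicontinuous ::
    "'i set \<Rightarrow> ('i \<Rightarrow> 'a::real_topological_vector_space \<Rightarrow> 'a) \<Rightarrow> bool"
  where "sequentially_equicontinuous I f \<longleftrightarrow>
    (\<forall>x (xs :: nat \<Rightarrow> 'a). xs \<longlonglongrightarrow> x \<longrightarrow>
      (\<forall>U. open U \<and> 0 \<in> U \<longrightarrow>
        (\<exists>N. \<forall>i\<in>I. \<forall>n\<ge>N. f i (xs n) \<in> (\<lambda>u. f i x + u) ` U)))"

(* Only the values of T on {0..} matter; those at negative times are unconstrained. *)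
locale C0_sequentially_equicontinuous_semigroup =
  fixes T :: "real \<Rightarrow> 'a::hausdorff_locally_convex_space \<Rightarrow> 'a"
  assumes linear: "t \<ge> 0 \<Longrightarrow> linear (T t)"
    and zero: "T 0 x = x"
    and add: "t \<ge> 0 \<Longrightarrow> s \<ge> 0 \<Longrightarrow> T (t + s) x = T t (T s x)"
    and right_continuous: "((\<lambda>t. T t x) \<longlongrightarrow> x) (at_right 0)"
    and equicontinuous: "sequentially_equicontinuous {0..} T"

definition generator_domain ::
    "(real \<Rightarrow> 'a::hausdorff_locally_convex_space \<Rightarrow> 'a) \<Rightarrow> 'a set"
  where "generator_domain T = {x. \<exists>y. ((\<lambda>h. (T h x - x) /\<^sub>R h) \<longlongrightarrow> y) (at_right 0)}"

(* As a partial function, so that equality of generators includes equality of domains. *)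
definition infinitesimal_generator ::
    "(real \<Rightarrow> 'a::hausdorff_locally_convex_space \<Rightarrow> 'a) \<Rightarrow> ('a \<rightharpoonup> 'a)"
  where "infinitesimal_generator T x =
    (if x \<in> generator_domain T then Some (Lim (at_right 0) (\<lambda>h. (T h x - x) /\<^sub>R h)) else None)"

(* Limit of the Riemann sums, with arbitrary tags, as the mesh of the division tends to 0;
   measure lborel K is the length of the subinterval K. *)
definition has_riemann_integral ::
    "(real \<Rightarrow> 'a::hausdorff_locally_convex_space) \<Rightarrow> 'a \<Rightarrow> real \<Rightarrow> real \<Rightarrow> bool"
  where "has_riemann_integral f y a b \<longleftrightarrow>
    (\<forall>U. open U \<and> y \<in> U \<longrightarrow>
      (\<exists>d>0. \<forall>p. p tagged_division_of {a..b} \<and> (\<forall>(t, K)\<in>p. measure lborel K < d) \<longrightarrow>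
        (\<Sum>(t, K)\<in>p. measure lborel K *\<^sub>R f t) \<in> U))"

definition generalized_riemann_integrable ::
    "(real \<Rightarrow> 'a::hausdorff_locally_convex_space) \<Rightarrow> bool"
  where "generalized_riemann_integrable f \<longleftrightarrow>
    (\<exists>F y. (\<forall>a\<ge>0. has_riemann_integral f (F a) 0 a) \<and> (F \<longlongrightarrow> y) at_top)"

end

theory Submission
  imports Defs
begin

text \<open>
  On the common domain of the generators the two semigroups agree: for \<open>x\<close> in it, the curve
  \<open>s \<mapsto> S (t - s) (T s x)\<close> joins \<open>S t x\<close> at \<open>s = 0\<close> to \<open>T t x\<close> at \<open>s = t\<close>, and its right derivative is
  the limit of \<open>S (t - s - h)\<close> applied to the difference of the two difference quotients at
  \<open>T s x\<close>. Both quotients tend to the generator at \<open>T s x\<close>, so their difference tends to \<open>0\<close>, and sequential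
  equicontinuity carries this through the operators at moving times
  (\<open>semigroups_agree_on_domain\<close>). A continuous curve with vanishing right derivative is constant
  (\<open>constant_if_right_derivative_zero\<close>); closed convex neighbourhoods take the place of
  functionals or seminorms in that mean value argument.

  It remains to see that the domain is sequentially dense, since all operators are sequentially
  continuous and limits are unique. Let \<open>F a\<close> be the integral of \<open>exp (- t) *\<^sub>R T t x\<close> over \<open>{0..a}\<close>.
  Its means \<open>F h /\<^sub>R h\<close> tend to \<open>x\<close> as \<open>h\<close> tends to \<open>0\<close>. Writing \<open>G a = exp (- a) *\<^sub>R T a\<close>, cutting the
  interval of integration at one point gives \<open>F (a + b) = F a + G a (F b)\<close>
  (\<open>discounted_integral_add\<close>). As the left side is symmetric in \<open>a\<close> and \<open>b\<close>,
  \<open>(G h (F a) - F a) / h = (G a (F h) - F h) / h\<close>,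
  which tends to \<open>G a x - x\<close>; hence \<open>F a\<close> lies in the domain
  (\<open>discounted_integral_in_generator_domain\<close>).
\<close>

section \<open>Closed convex neighbourhoods and the mean value argument\<close>

lemma tendsto_scaleR_tvs:
  fixes g :: "'b \<Rightarrow> 'a::real_topological_vector_space"
  assumes "(f \<longlongrightarrow> c) F" "(g \<longlongrightarrow> x) F"
  shows "((\<lambda>u. f u *\<^sub>R g u) \<longlongrightarrow> c *\<^sub>R x) F"
  using filterlim_compose[OF tendsto_scaleR_Pair filterlim_Pair[OF assms]] by simp

lemma convex_closure_tvs:
  fixes V :: "'a::real_topological_vector_space set"
  assumes "convex V"
  shows "convex (closure V)"
proof (rule convexI)
  fix x y :: 'a and u v :: real
  assume xy: "x \<in> closure V" "y \<in> closure V" and uv: "0 \<le> u" "0 \<le> v" "u + v = 1"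
  let ?f = "\<lambda>p. u *\<^sub>R fst p + v *\<^sub>R snd p :: 'a"
  have "continuous_on (closure (V \<times> V)) ?f"
    unfolding continuous_on_def
    by (intro ballI tendsto_add tendsto_scaleR_tvs tendsto_const tendsto_fst tendsto_snd tendsto_ident_at)
  moreover have "?f ` (V \<times> V) \<subseteq> closure V"
    using convexD[OF assms _ _ uv] closure_subset[of V] by auto
  ultimately have "?f ` closure (V \<times> V) \<subseteq> closure V"
    by (intro image_closure_subset) auto
  then show "u *\<^sub>R x + v *\<^sub>R y \<in> closure V"
    using xy by (auto simp: closure_Times image_subset_iff)
qed

text \<open>
  The closure of \<open>V\<close> lies in \<open>V - V\<close>, because the neighbourhood \<open>z + V\<close> of a point \<open>z\<close> of the closure
  meets \<open>V\<close>. So it suffices to choose \<open>V\<close> with \<open>V - V\<close> inside \<open>U\<close>.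
\<close>

lemma closed_convex_neighbourhood:
  fixes U :: "'a::hausdorff_locally_convex_space set"
  assumes "open U" "0 \<in> U"
  obtains V where "open V" "0 \<in> V" "convex (closure V)" "closure V \<subseteq> U"
proof -
  have "((\<lambda>p. fst p - snd p) \<longlongrightarrow> (0::'a) - 0) (nhds 0 \<times>\<^sub>F nhds 0)"
    by (intro tendsto_diff filterlim_fst filterlim_snd)
  then have "\<forall>\<^sub>F p in nhds (0::'a) \<times>\<^sub>F nhds 0. fst p - snd p \<in> U"
    using assms by (auto dest: topological_tendstoD)
  then obtain P Q where "\<forall>\<^sub>F x in nhds (0::'a). P x" "\<forall>\<^sub>F x in nhds (0::'a). Q x"
    and PQ: "\<And>x y. P x \<Longrightarrow> Q y \<Longrightarrow> x - y \<in> U"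
    unfolding eventually_prod_filter by auto
  then obtain W where W: "open W" "0 \<in> W" "\<And>x. x \<in> W \<Longrightarrow> P x \<and> Q x"
    using eventually_conj[of P "nhds 0" Q] unfolding eventually_nhds by metis
  obtain V where V: "open V" "0 \<in> V" "convex V" "V \<subseteq> W"
    using convex_neighbourhood_base[OF W(1,2)] unfolding convex_def by metis
  have "z \<in> U" if z: "z \<in> closure V" for z
  proof -
    have "open ((\<lambda>w. w - z) -` V)"
      using V(1) by (intro open_vimage continuous_on_diff continuous_on_id continuous_on_const)
    then have "V \<inter> (\<lambda>w. w - z) -` V \<noteq> {}"
      using z V(2) open_Int_closure_eq_empty[of "(\<lambda>w. w - z) -` V" V]
      by (auto simp: set_eq_iff)
    then obtain v where "v \<in> V" "v - z \<in> V" by auto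
    then have "v - (v - z) \<in> U" using V(4) W(3) PQ by blast
    then show ?thesis by simp
  qed
  then have "closure V \<subseteq> U" by blast
  then show thesis by (rule that[OF V(1,2) convex_closure_tvs[OF V(3)]])
qed

text \<open>
  The increments \<open>f s - f 0\<close> stay in \<open>s\<close> times a closed convex neighbourhood \<open>C\<close> of \<open>0\<close>. The set of
  such \<open>s\<close> is closed by continuity, and it has no largest element before \<open>t\<close>: the right derivative
  puts the next increment of length \<open>h\<close> into \<open>h\<close> times \<open>C\<close>, and convexity adds the two. As \<open>C\<close> can
  be chosen to miss any given nonzero vector, the mean slope over \<open>{0..t}\<close> is \<open>0\<close>.
\<close>

lemma constant_if_right_derivative_zero:
  fixes f :: "real \<Rightarrow> 'a::hausdorff_locally_convex_space"
  assumes t: "t > 0" and cont: "continuous_on {0..t} f"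
    and deriv: "\<And>s. 0 \<le> s \<Longrightarrow> s < t \<Longrightarrow> ((\<lambda>h. (f (s + h) - f s) /\<^sub>R h) \<longlongrightarrow> 0) (at_right 0)"
  shows "f t = f 0"
proof (rule ccontr)
  assume ne: "f t \<noteq> f 0"
  let ?U = "- {(f t - f 0) /\<^sub>R t}"
  have "open ?U" "0 \<in> ?U" using ne t by auto
  then obtain V where V: "open V" "0 \<in> V" "convex (closure V)" "closure V \<subseteq> ?U"
    by (rule closed_convex_neighbourhood)
  define C where "C = closure V"
  define E where "E = {s \<in> {0..t}. \<exists>v\<in>C. f s - f 0 = s *\<^sub>R v}"
  have E0: "0 \<in> E" using V closure_subset[of V] t by (auto simp: E_def C_def)
  have clE: "closed E"
    unfolding closed_sequential_limits
  proof (intro allI impI, elim conjE)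
    fix s c assume s: "\<forall>n. s n \<in> E" "s \<longlonglongrightarrow> c"
    have c: "c \<in> {0..t}"
      by (rule closed_sequentially[OF _ _ s(2)]) (use s(1) in \<open>auto simp: E_def\<close>)
    show "c \<in> E"
    proof (cases "c = 0")
      case False
      with c have cp: "c > 0" by simp
      have "(\<lambda>n. f (s n)) \<longlonglongrightarrow> f c"
        using cont s c by (intro continuous_on_tendsto_compose[OF cont]) (auto simp: E_def)
      then have lim: "(\<lambda>n. (f (s n) - f 0) /\<^sub>R s n) \<longlonglongrightarrow> (f c - f 0) /\<^sub>R c"
        using s cp by (intro tendsto_scaleR_tvs tendsto_inverse tendsto_diff tendsto_const) auto
      have "\<forall>\<^sub>F n in sequentially. (f (s n) - f 0) /\<^sub>R s n \<in> C"
        using order_tendstoD(1)[OF s(2) cp]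
      proof eventually_elim
        case (elim n)
        then show ?case using s(1)[rule_format, of n] by (auto simp: E_def)
      qed
      then have "(f c - f 0) /\<^sub>R c \<in> C"
        using lim by (intro Lim_in_closed_set[of C]) (auto simp: C_def)
      moreover have "f c - f 0 = c *\<^sub>R ((f c - f 0) /\<^sub>R c)" using cp by simp
      ultimately show ?thesis using c unfolding E_def by blast
    qed (use E0 in simp)
  qed
  define c where "c = Sup E"
  have bdd: "bdd_above E" by (auto simp: E_def bdd_above_def)
  have "c \<in> E"
    unfolding c_def using E0 bdd clE by (intro closed_contains_Sup) auto
  then obtain v where v: "v \<in> C" "f c - f 0 = c *\<^sub>R v" and c: "0 \<le> c" "c \<le> t" by (auto simp: E_def)
  have "c = t"
  proof (rule ccontr)
    assume "c \<noteq> t"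
    then have ct: "c < t" using c by simp
    have "\<forall>\<^sub>F h in at_right 0. (f (c + h) - f c) /\<^sub>R h \<in> V"
      using topological_tendstoD[OF deriv[OF c(1) ct] V(1,2)] .
    moreover have "\<forall>\<^sub>F h in at_right 0. h < t - c \<and> h > 0"
      using ct by (auto simp: eventually_at_right_field intro!: exI[of _ "t - c"])
    ultimately have "\<forall>\<^sub>F h in at_right (0::real). (f (c + h) - f c) /\<^sub>R h \<in> V \<and> h < t - c \<and> h > 0"
      by (rule eventually_conj)
    then obtain h where h: "(f (c + h) - f c) /\<^sub>R h \<in> V" "h < t - c" "h > 0"
      using eventually_happens[of _ "at_right (0::real)"] by auto
    define w where "w = (f (c + h) - f c) /\<^sub>R h"
    \<comment> \<open>The mean slope over \<open>{0..c + h}\<close> is a convex combination of those over \<open>{0..c}\<close> and \<open>{c..c + h}\<close>.\<close>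
    define u where "u = (c / (c + h)) *\<^sub>R v + (h / (c + h)) *\<^sub>R w"
    have "u \<in> C" unfolding u_def C_def
      using v(1) h closure_subset[of V] c
      by (intro convexD[OF V(3)]) (auto simp: w_def C_def add_divide_distrib[symmetric])
    moreover have "f (c + h) - f 0 = (c + h) *\<^sub>R u"
    proof -
      have "f (c + h) - f c = h *\<^sub>R w" using h by (simp add: w_def)
      then have "f (c + h) - f 0 = c *\<^sub>R v + h *\<^sub>R w" using v(2) by (simp add: algebra_simps)
      also have "\<dots> = (c + h) *\<^sub>R u" using h c by (simp add: u_def scaleR_add_right)
      finally show ?thesis .
    qed
    ultimately have "c + h \<in> E" using h c by (auto simp: E_def)
    then have "c + h \<le> c" unfolding c_def using bdd by (rule cSup_upper)
    then show False using h by simp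
  qed
  then have "(f t - f 0) /\<^sub>R t \<in> C" using v t by simp
  then show False using V(4) by (auto simp: C_def)
qed

section \<open>Semigroups with the same generator agree on its domain\<close>

context C0_sequentially_equicontinuous_semigroup
begin

lemma equicontinuous_at:
  assumes "X \<longlonglongrightarrow> x" "open U" "0 \<in> U"
  obtains N where "\<forall>t\<ge>0. \<forall>n\<ge>N. T t (X n) \<in> (\<lambda>u. T t x + u) ` U"
proof -
  have "\<exists>N. \<forall>t\<in>{0..}. \<forall>n\<ge>N. T t (X n) \<in> (\<lambda>u. T t x + u) ` U"
    using assms(2,3)
    by (intro equicontinuous[unfolded sequentially_equicontinuous_def, rule_format, OF assms(1)] conjI)
  then obtain N where N: "\<forall>t\<in>{0..}. \<forall>n\<ge>N. T t (X n) \<in> (\<lambda>u. T t x + u) ` U" ..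
  show thesis
    by (rule that[of N]) (intro allI impI, rule N[rule_format], simp_all)
qed

text \<open>
  This is how equicontinuity enters: the time \<open>r h\<close> may vary with \<open>h\<close> without any limit. Filters at a
  real point are determined by sequences, so the sequential form of equicontinuity is enough.
\<close>

lemma tendsto_zero_at_moving_times:
  fixes c :: real
  assumes z: "(z \<longlongrightarrow> 0) (at c within A)" and r: "\<And>h. h \<in> A \<Longrightarrow> r h \<ge> 0"
  shows "((\<lambda>h. T (r h) (z h)) \<longlongrightarrow> 0) (at c within A)"
  unfolding tendsto_at_iff_sequentially
proof (intro allI impI)
  fix X :: "nat \<Rightarrow> real"
  assume X: "\<forall>i. X i \<in> A - {c}" "X \<longlonglongrightarrow> c"
  then have zX: "(\<lambda>n. z (X n)) \<longlonglongrightarrow> 0"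
    using z unfolding tendsto_at_iff_sequentially by (auto simp: o_def)
  show "((\<lambda>h. T (r h) (z h)) \<circ> X) \<longlonglongrightarrow> 0"
  proof (rule topological_tendstoI)
    fix U :: "'a set" assume "open U" "0 \<in> U"
    with zX obtain N where N: "\<forall>i\<ge>0. \<forall>n\<ge>N. T i (z (X n)) \<in> (\<lambda>u. T i 0 + u) ` U"
      by (rule equicontinuous_at)
    have "T (r (X n)) (z (X n)) \<in> U" if "n \<ge> N" for n
    proof -
      have nonneg: "r (X n) \<ge> 0" using X(1) r by blast
      from N[rule_format, OF this that] obtain u where "T (r (X n)) (z (X n)) = T (r (X n)) 0 + u" "u \<in> U"
        by (rule imageE)
      then show ?thesis using linear_0[OF linear[OF nonneg]] by simp
    qed
    then show "\<forall>\<^sub>F n in sequentially. ((\<lambda>h. T (r h) (z h)) \<circ> X) n \<in> U"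
      by (auto simp: eventually_sequentially)
  qed
qed

lemma sequentially_continuous:
  assumes "X \<longlonglongrightarrow> x" "t \<ge> 0"
  shows "(\<lambda>n. T t (X n)) \<longlonglongrightarrow> T t x"
proof (rule topological_tendstoI)
  fix U assume U: "open U" "T t x \<in> U"
  let ?U = "(\<lambda>u. T t x + u) -` U"
  have "open ?U" "0 \<in> ?U"
    using U by (auto intro!: open_vimage continuous_on_add continuous_on_id continuous_on_const)
  with assms(1) obtain N where
    N: "\<forall>i\<ge>0. \<forall>n\<ge>N. T i (X n) \<in> (\<lambda>u. T i x + u) ` ?U"
    by (rule equicontinuous_at)
  have "T t (X n) \<in> U" if "n \<ge> N" for n
    using N[rule_format, OF assms(2) that] by (rule subsetD[OF image_vimage_subset])
  then show "\<forall>\<^sub>F n in sequentially. T t (X n) \<in> U"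
    unfolding eventually_sequentially by blast
qed

lemma tendsto_operator:
  fixes c :: real
  assumes "(z \<longlongrightarrow> y) (at c within A)" "t \<ge> 0"
  shows "((\<lambda>h. T t (z h)) \<longlongrightarrow> T t y) (at c within A)"
  using assms sequentially_continuous unfolding tendsto_at_iff_sequentially o_def by blast

lemma generator_domain_invariant:
  assumes "x \<in> generator_domain T" "s \<ge> 0"
  shows "T s x \<in> generator_domain T"
proof -
  obtain y where y: "((\<lambda>h. (T h x - x) /\<^sub>R h) \<longlongrightarrow> y) (at_right 0)"
    using assms by (auto simp: generator_domain_def)
  have "\<forall>\<^sub>F h in at_right 0. T s ((T h x - x) /\<^sub>R h) = (T h (T s x) - T s x) /\<^sub>R h"
    using eventually_at_right_less[of 0]
  proof eventually_elim
    case (elim h)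
    then show ?case using linear[OF assms(2)] add[of h s x] add[of s h x] assms(2)
      by (simp add: linear_scale linear_diff add.commute)
  qed
  then have "((\<lambda>h. (T h (T s x) - T s x) /\<^sub>R h) \<longlongrightarrow> T s y) (at_right 0)"
    using tendsto_operator[OF y assms(2)] tendsto_cong by force
  then show ?thesis by (auto simp: generator_domain_def)
qed

lemma tendsto_infinitesimal_generator:
  assumes "infinitesimal_generator T x = Some y"
  shows "((\<lambda>h. (T h x - x) /\<^sub>R h) \<longlongrightarrow> y) (at_right 0)"
proof -
  obtain z where z: "((\<lambda>h. (T h x - x) /\<^sub>R h) \<longlongrightarrow> z) (at_right 0)"
    using assms by (auto simp: generator_domain_def infinitesimal_generator_def split: if_splits)
  then have "x \<in> generator_domain T" by (auto simp: generator_domain_def)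
  then have "y = Lim (at_right 0) (\<lambda>h. (T h x - x) /\<^sub>R h)"
    using assms by (auto simp: infinitesimal_generator_def)
  then show ?thesis using tendsto_Lim[OF _ z] z by simp
qed

text \<open>
  Left continuity of orbits is stated as a limit of differences within \<open>{0..s}\<close>, where every time
  \<open>s - h\<close> is nonnegative. It needs equicontinuity, because the operator \<open>T (s - h)\<close> factored out of the
  difference varies with \<open>h\<close>.
\<close>

lemma orbit_left_continuous:
  assumes "s > 0"
  shows "((\<lambda>h. T s x - T (s - h) x) \<longlongrightarrow> 0) (at 0 within {0..s})"
proof -
  have "((\<lambda>h. T h x) \<longlongrightarrow> x) (at 0 within {0..s})"
    using right_continuous assms by (simp add: at_within_Icc_at_right)
  then have "((\<lambda>h. T h x - x) \<longlongrightarrow> x - x) (at 0 within {0..s})"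
    by (intro tendsto_diff tendsto_const)
  then have "((\<lambda>h. T (s - h) (T h x - x)) \<longlongrightarrow> 0) (at 0 within {0..s})"
    by (intro tendsto_zero_at_moving_times) auto
  then show ?thesis
  proof (rule Lim_transform_within[where d=1])
    fix h assume "h \<in> {0..s}"
    then show "T (s - h) (T h x - x) = T s x - T (s - h) x"
      using add[of "s - h" h x] linear[of "s - h"] by (simp add: linear_diff)
  qed simp
qed

end

text \<open>
  The curve \<open>s \<mapsto> S (t - s) (T s x)\<close> is constant. Only right derivatives are computed: for a left
  increment the factors would be \<open>T h\<close> and \<open>S h\<close> at the moving point \<open>T (s - h) x\<close>, where the difference
  quotients have no evident limit. For left continuity, which has no division by \<open>h\<close>, the moving
  point is harmless.
\<close>

lemma semigroups_agree_on_domain: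
  fixes T S :: "real \<Rightarrow> 'a::hausdorff_locally_convex_space \<Rightarrow> 'a"
  assumes T: "C0_sequentially_equicontinuous_semigroup T"
    and S: "C0_sequentially_equicontinuous_semigroup S"
    and gen: "infinitesimal_generator S = infinitesimal_generator T"
    and x: "x \<in> generator_domain T" and t: "t > 0"
  shows "S t x = T t x"
proof -
  interpret T: C0_sequentially_equicontinuous_semigroup T by fact
  interpret S: C0_sequentially_equicontinuous_semigroup S by fact
  define f where "f s = S (t - s) (T s x)" for s
  have right: "f (s + h) - f s = S (t - (s + h)) (T h (T s x) - S h (T s x))"
    if "0 \<le> s" "0 \<le> h" "s + h \<le> t" for s h
    using that T.add[of h s x] S.add[of "t - (s + h)" h "T s x"] S.linear[of "t - (s + h)"]
    by (simp add: f_def linear_diff add.commute)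
  have right_cont: "((\<lambda>h. f (s + h)) \<longlongrightarrow> f s) (at_right 0)" if s: "0 \<le> s" "s < t" for s
  proof -
    let ?I = "{0..t - s}"
    have at: "at (0::real) within ?I = at_right 0" using s by (simp add: at_within_Icc_at_right)
    have "((\<lambda>h. T h (T s x) - S h (T s x)) \<longlongrightarrow> T s x - T s x) (at_right 0)"
      by (intro tendsto_diff T.right_continuous S.right_continuous)
    then have "((\<lambda>h. S (t - (s + h)) (T h (T s x) - S h (T s x))) \<longlongrightarrow> 0) (at 0 within ?I)"
      by (intro S.tendsto_zero_at_moving_times) (auto simp: at)
    then have "((\<lambda>h. f (s + h) - f s) \<longlongrightarrow> 0) (at 0 within ?I)"
      by (rule Lim_transform_within[where d=1]) (use s right in auto)
    then have "((\<lambda>h. f (s + h) - f s + f s) \<longlongrightarrow> 0 + f s) (at_right 0)"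
      unfolding at by (intro tendsto_add tendsto_const)
    then show ?thesis by simp
  qed
  have left_cont: "((\<lambda>h. f (s - h)) \<longlongrightarrow> f s) (at_right 0)" if s: "0 < s" "s \<le> t" for s
  proof -
    let ?I = "{0..s}"
    have at: "at (0::real) within ?I = at_right 0" using s by (simp add: at_within_Icc_at_right)
    have "((\<lambda>h. T s x - S h (T s x)) \<longlongrightarrow> T s x - T s x) (at 0 within ?I)"
      unfolding at by (intro tendsto_diff tendsto_const S.right_continuous)
    moreover have "((\<lambda>h. S h (T s x - T (s - h) x)) \<longlongrightarrow> 0) (at 0 within ?I)"
      using T.orbit_left_continuous[OF s(1)] by (intro S.tendsto_zero_at_moving_times) auto
    ultimately have "((\<lambda>h. (T s x - S h (T s x)) + S h (T s x - T (s - h) x)) \<longlongrightarrow> (T s x - T s x) + 0) (at 0 within ?I)"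
      by (rule tendsto_add)
    then have "((\<lambda>h. S (t - s) ((T s x - S h (T s x)) + S h (T s x - T (s - h) x))) \<longlongrightarrow> 0) (at 0 within ?I)"
      using s by (intro S.tendsto_zero_at_moving_times) auto
    then have "((\<lambda>h. f s - f (s - h)) \<longlongrightarrow> 0) (at 0 within ?I)"
    proof (rule Lim_transform_within[where d=1])
      fix h assume "h \<in> ?I"
      then show "S (t - s) ((T s x - S h (T s x)) + S h (T s x - T (s - h) x)) = f s - f (s - h)"
        using s S.linear[of h] S.linear[of "t - s"] S.add[of "t - s" h "T (s - h) x"]
        by (simp add: f_def linear_diff linear_add algebra_simps)
    qed simp
    then have "((\<lambda>h. f s - (f s - f (s - h))) \<longlongrightarrow> f s - 0) (at_right 0)"
      unfolding at by (intro tendsto_diff tendsto_const)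
    then show ?thesis by simp
  qed
  have "f t = f 0"
  proof (rule constant_if_right_derivative_zero[OF t])
    show "continuous_on {0..t} f"
      unfolding continuous_on_def
    proof
      fix s assume s: "s \<in> {0..t}"
      have "(f \<longlongrightarrow> f s) (at s within {s..t})"
      proof (cases "s < t")
        case True
        then show ?thesis using right_cont[of s] s
          by (simp add: at_within_Icc_at_right filterlim_at_right_to_0[of f _ s] add.commute)
      qed (use s in \<open>auto simp: not_less at_within_def\<close>)
      moreover have "(f \<longlongrightarrow> f s) (at s within {0..s})"
      proof (cases "0 < s")
        case True
        have "((\<lambda>h. f (- h)) \<longlongrightarrow> f s) (at_right (- s))"
          unfolding filterlim_at_right_to_0[of _ _ "- s"] using left_cont[of s] s True by simp
        then show ?thesis using True
          by (simp add: at_within_Icc_at_left filterlim_at_left_to_right)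
      qed (use s in \<open>auto simp: not_less at_within_def\<close>)
      ultimately have "(f \<longlongrightarrow> f s) (at s within {0..s} \<union> {s..t})"
        by (simp add: Lim_Un)
      then show "(f \<longlongrightarrow> f s) (at s within {0..t})"
        using s by (simp add: ivl_disj_un_two_touch)
    qed
  next
    fix s assume s: "0 \<le> s" "s < t"
    let ?I = "{0..t - s}"
    have at: "at (0::real) within ?I = at_right 0" using s by (simp add: at_within_Icc_at_right)
    obtain y where y: "infinitesimal_generator T (T s x) = Some y"
      using T.generator_domain_invariant[OF x s(1)] by (auto simp: infinitesimal_generator_def)
    have "((\<lambda>h. (T h (T s x) - T s x) /\<^sub>R h - (S h (T s x) - T s x) /\<^sub>R h) \<longlongrightarrow> y - y) (at_right 0)"
      using y gen
      by (intro tendsto_diff T.tendsto_infinitesimal_generator S.tendsto_infinitesimal_generator) auto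
    then have "((\<lambda>h. S (t - (s + h)) ((T h (T s x) - T s x) /\<^sub>R h - (S h (T s x) - T s x) /\<^sub>R h)) \<longlongrightarrow> 0) (at 0 within ?I)"
      by (intro S.tendsto_zero_at_moving_times) (auto simp: at)
    then have "((\<lambda>h. (f (s + h) - f s) /\<^sub>R h) \<longlongrightarrow> 0) (at 0 within ?I)"
    proof (rule Lim_transform_within[where d=1])
      fix h assume h: "h \<in> ?I"
      have "(T h (T s x) - T s x) /\<^sub>R h - (S h (T s x) - T s x) /\<^sub>R h
          = (T h (T s x) - S h (T s x)) /\<^sub>R h"
        by (simp add: scaleR_diff_right)
      then show "S (t - (s + h)) ((T h (T s x) - T s x) /\<^sub>R h - (S h (T s x) - T s x) /\<^sub>R h)
          = (f (s + h) - f s) /\<^sub>R h"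
        using h s right[of s h] S.linear[of "t - (s + h)"] by (simp add: linear_scale)
    qed simp
    then show "((\<lambda>h. (f (s + h) - f s) /\<^sub>R h) \<longlongrightarrow> 0) (at_right 0)" by (simp add: at)
  qed
  then show ?thesis by (simp add: f_def S.zero T.zero)
qed

section \<open>Riemann integrals as limits of uniform sums\<close>

text \<open>
  Tags strictly left of \<open>v\<close> and not left of \<open>u\<close> make divisions of adjacent intervals disjoint as sets,
  so that sums simply add when the divisions are joined.
\<close>

definition is_left_sum ::
    "(real \<Rightarrow> 'a::hausdorff_locally_convex_space) \<Rightarrow> real \<Rightarrow> real \<Rightarrow> real \<Rightarrow> 'a \<Rightarrow> bool"
  where "is_left_sum g d u v \<sigma> \<longleftrightarrow>
    (\<exists>p. p tagged_division_of {u..v} \<and> (\<forall>(t, K)\<in>p. measure lborel K < d \<and> u \<le> t \<and> t < v) \<and>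
      (\<Sum>(t, K)\<in>p. measure lborel K *\<^sub>R g t) = \<sigma>)"

lemma is_left_sum_single:
  assumes "0 < c" "c < d"
  shows "is_left_sum g d u (u + c) (c *\<^sub>R g u)"
  unfolding is_left_sum_def
  using assms tagged_division_of_self_real[of u u "u + c"]
  by (intro exI[of _ "{(u, {u..u + c})}"]) auto

lemma is_left_sum_append:
  assumes "is_left_sum g d u v \<sigma>" "is_left_sum g d v w \<tau>" "u \<le> v" "v \<le> w"
  shows "is_left_sum g d u w (\<sigma> + \<tau>)"
proof -
  obtain p where p: "p tagged_division_of {u..v}"
      "\<And>t K. (t, K) \<in> p \<Longrightarrow> measure lborel K < d \<and> u \<le> t \<and> t < v"
      "(\<Sum>(t, K)\<in>p. measure lborel K *\<^sub>R g t) = \<sigma>"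
    using assms(1) unfolding is_left_sum_def by blast
  obtain q where q: "q tagged_division_of {v..w}"
      "\<And>t K. (t, K) \<in> q \<Longrightarrow> measure lborel K < d \<and> v \<le> t \<and> t < w"
      "(\<Sum>(t, K)\<in>q. measure lborel K *\<^sub>R g t) = \<tau>"
    using assms(2) unfolding is_left_sum_def by blast
  have "p \<union> q tagged_division_of {u..v} \<union> {v..w}"
    using p(1) q(1) by (rule tagged_division_Un) auto
  then have un: "p \<union> q tagged_division_of {u..w}"
    using assms(3,4) by (simp add: ivl_disj_un_two_touch)
  have "p \<inter> q = {}" using p(2) q(2) by fastforce
  then have "(\<Sum>(t, K)\<in>p \<union> q. measure lborel K *\<^sub>R g t) = \<sigma> + \<tau>"
    using p(1,3) q(1,3) by (subst sum.union_disjoint) (auto simp: tagged_division_of_def tagged_partial_division_of_def)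
  moreover have "\<forall>(t, K)\<in>p \<union> q. measure lborel K < d \<and> u \<le> t \<and> t < w"
    using p(2) q(2) assms(3,4) by fastforce
  ultimately show ?thesis using un unfolding is_left_sum_def by blast
qed

text \<open>
  There are \<open>Suc n\<close> cells rather than \<open>n\<close>, so that no index gives an empty division or a division by
  \<open>0\<close>.
\<close>

definition uniform_sum :: "(real \<Rightarrow> 'a::real_vector) \<Rightarrow> real \<Rightarrow> real \<Rightarrow> nat \<Rightarrow> 'a"
  where "uniform_sum g u a n = (\<Sum>k\<le>n. (a / Suc n) *\<^sub>R g (u + real k * (a / Suc n)))"

lemma is_left_sum_uniform_sum:
  assumes "a > 0" "a / Suc n < d"
  shows "is_left_sum g d u (u + a) (uniform_sum g u a n)"
proof -
  have "is_left_sum g d u (u + real (Suc m) * c) (\<Sum>k\<le>m. c *\<^sub>R g (u + real k * c))"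
    if c: "0 < c" "c < d" for m c
  proof (induction m)
    case 0
    show ?case using is_left_sum_single[OF c] by simp
  next
    case (Suc m)
    have "is_left_sum g d (u + real (Suc m) * c) (u + real (Suc m) * c + c) (c *\<^sub>R g (u + real (Suc m) * c))"
      by (rule is_left_sum_single[OF c])
    from is_left_sum_append[OF Suc this] c show ?case by (simp add: algebra_simps)
  qed
  from this[of "a / Suc n" n] show ?thesis using assms by (simp add: uniform_sum_def)
qed

lemma eventually_fine: "d > 0 \<Longrightarrow> \<forall>\<^sub>F n in sequentially. a / real (Suc n) < d"
  using order_tendstoD(2)[OF LIMSEQ_Suc[OF lim_const_over_n]] by force

lemma left_sums_tendsto_riemann_integral:
  assumes int: "has_riemann_integral g y a b"
    and sums: "\<And>d. d > 0 \<Longrightarrow> \<forall>\<^sub>F n in sequentially. is_left_sum g d a b (\<sigma> n)"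
  shows "\<sigma> \<longlonglongrightarrow> y"
proof (rule topological_tendstoI)
  fix U assume "open U" "y \<in> U"
  then obtain d where d: "d > 0" "\<And>p. p tagged_division_of {a..b} \<Longrightarrow> \<forall>(t, K)\<in>p. measure lborel K < d \<Longrightarrow>
        (\<Sum>(t, K)\<in>p. measure lborel K *\<^sub>R g t) \<in> U"
    using int unfolding has_riemann_integral_def by metis
  show "\<forall>\<^sub>F n in sequentially. \<sigma> n \<in> U"
    using sums[OF d(1)]
  proof eventually_elim
    case (elim n)
    then show ?case using d(2) unfolding is_left_sum_def by fastforce
  qed
qed

lemma uniform_sum_tendsto:
  assumes "has_riemann_integral g y 0 a" "a > 0"
  shows "uniform_sum g 0 a \<longlonglongrightarrow> y"
proof (rule left_sums_tendsto_riemann_integral[OF assms(1)])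
  fix d :: real assume "d > 0"
  from eventually_fine[OF this, of a] show "\<forall>\<^sub>F n in sequentially. is_left_sum g d 0 a (uniform_sum g 0 a n)"
  proof eventually_elim
    case (elim n)
    then show ?case using is_left_sum_uniform_sum[OF assms(2) elim, of g 0] by simp
  qed
qed

text \<open>
  The two parts may have different step widths, since \<open>a\<close> and \<open>b\<close> need not be commensurable; arbitrary
  divisions in the integral allow this.
\<close>

lemma split_uniform_sum_tendsto:
  assumes "has_riemann_integral g y 0 (a + b)" "a > 0" "b > 0"
  shows "(\<lambda>n. uniform_sum g 0 a n + uniform_sum g a b n) \<longlonglongrightarrow> y"
proof (rule left_sums_tendsto_riemann_integral[OF assms(1)])
  fix d :: real assume "d > 0"
  from eventually_fine[OF this, of a] eventually_fine[OF this, of b]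
  show "\<forall>\<^sub>F n in sequentially. is_left_sum g d 0 (a + b) (uniform_sum g 0 a n + uniform_sum g a b n)"
  proof eventually_elim
    case (elim n)
    then show ?case
      using is_left_sum_append[OF _ is_left_sum_uniform_sum[OF assms(3) elim(2), of g a]]
        is_left_sum_uniform_sum[OF assms(2) elim(1), of g 0] assms(2,3) by simp
  qed
qed

text \<open>
  A uniform sum divided by the length of the interval is a convex combination of values of \<open>g\<close>; close
  to \<open>0\<close> these values lie in a prescribed closed convex neighbourhood of \<open>g 0\<close>, and so does the limit.
\<close>

lemma riemann_integral_mean_tendsto:
  fixes g :: "real \<Rightarrow> 'a::hausdorff_locally_convex_space"
  assumes cont: "(g \<longlongrightarrow> g 0) (at_right 0)"
    and int: "\<And>h. h > 0 \<Longrightarrow> has_riemann_integral g (F h) 0 h"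
  shows "((\<lambda>h. F h /\<^sub>R h) \<longlongrightarrow> g 0) (at_right 0)"
proof (rule topological_tendstoI)
  fix U assume U: "open U" "g 0 \<in> U"
  let ?U = "(\<lambda>u. g 0 + u) -` U"
  have "open ?U" "0 \<in> ?U"
    using U by (auto intro!: open_vimage continuous_on_add continuous_on_id continuous_on_const)
  then obtain V where V: "open V" "0 \<in> V" "convex (closure V)" "closure V \<subseteq> ?U"
    by (rule closed_convex_neighbourhood)
  have "((\<lambda>t. g t - g 0) \<longlongrightarrow> g 0 - g 0) (at_right 0)"
    by (intro tendsto_diff cont tendsto_const)
  then have "\<forall>\<^sub>F t in at_right 0. g t - g 0 \<in> V"
    using topological_tendstoD V(1,2) by fastforce
  then obtain b where b: "b > 0" "\<And>t. 0 < t \<Longrightarrow> t < b \<Longrightarrow> g t - g 0 \<in> V"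
    unfolding eventually_at_right_field by auto
  have "F h /\<^sub>R h \<in> U" if h: "0 < h" "h < b" for h
  proof -
    have "uniform_sum g 0 h n /\<^sub>R h - g 0 \<in> closure V" for n
    proof -
      have "g (real k * (h / Suc n)) - g 0 \<in> closure V" if "k \<le> n" for k
      proof (cases "k = 0")
        case False
        have "k * (h / Suc n) < Suc n * (h / Suc n)"
          using h that by (intro mult_strict_right_mono) auto
        then show ?thesis using b(2)[of "k * (h / Suc n)"] False h closure_subset[of V] by fastforce
      qed (use V(2) closure_subset[of V] in auto)
      then have "(\<Sum>k\<le>n. (1 / Suc n) *\<^sub>R (g (real k * (h / Suc n)) - g 0)) \<in> closure V"
        using V(3) by (intro convex_sum) auto
      also have "(\<Sum>k\<le>n. (1 / Suc n) *\<^sub>R (g (real k * (h / Suc n)) - g 0))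
          = (\<Sum>k\<le>n. (1 / Suc n) *\<^sub>R g (real k * (h / Suc n))) - (\<Sum>k\<le>n. (1 / Suc n) *\<^sub>R g 0)"
        by (simp only: scaleR_diff_right sum_subtractf)
      also have "(\<Sum>k\<le>n. (1 / Suc n) *\<^sub>R g 0) = g 0"
        by (simp add: sum_constant_scaleR del: of_nat_Suc)
      also have "(\<Sum>k\<le>n. (1 / Suc n) *\<^sub>R g (real k * (h / Suc n))) = uniform_sum g 0 h n /\<^sub>R h"
        using h unfolding uniform_sum_def scaleR_sum_right by (intro sum.cong) (auto simp: field_simps)
      finally show ?thesis .
    qed
    then have "\<forall>n. uniform_sum g 0 h n /\<^sub>R h - g 0 \<in> closure V" ..
    moreover have "(\<lambda>n. uniform_sum g 0 h n /\<^sub>R h - g 0) \<longlonglongrightarrow> F h /\<^sub>R h - g 0"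
      using uniform_sum_tendsto[OF int[OF h(1)] h(1)]
      by (intro tendsto_diff tendsto_scaleR_tvs tendsto_const)
    ultimately have "F h /\<^sub>R h - g 0 \<in> closure V"
      by (intro Lim_in_closed_set[OF closed_closure]) auto
    then show ?thesis using V(4) by auto
  qed
  then show "\<forall>\<^sub>F h in at_right 0. F h /\<^sub>R h \<in> U"
    using b(1) unfolding eventually_at_right_field by auto
qed

section \<open>Sequential density of the domain\<close>

context C0_sequentially_equicontinuous_semigroup
begin

text \<open>
  On uniform sums, \<open>exp (- a) *\<^sub>R T a\<close> acts as translation of the integrand by \<open>a\<close>; sequential
  continuity of \<open>T a\<close> is just enough to pass to the limit along the sequence of uniform sums.
\<close>

lemma discounted_integral_add:
  assumes int: "\<And>r. r \<ge> 0 \<Longrightarrow> has_riemann_integral (\<lambda>t. exp (- t) *\<^sub>R T t x) (F r) 0 r"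
    and "a > 0" "b > 0"
  shows "F (a + b) = F a + exp (- a) *\<^sub>R T a (F b)"
proof -
  let ?g = "\<lambda>t. exp (- t) *\<^sub>R T t x"
  note la = linear[of a]
  have shift: "exp (- a) *\<^sub>R T a (uniform_sum ?g 0 b n) = uniform_sum ?g a b n" for n
  proof -
    have "exp (- a) *\<^sub>R T a (c *\<^sub>R ?g (k * d)) = c *\<^sub>R ?g (a + k * d)" if "k * d \<ge> 0" for c k d
      using la add[of a "k * d" x] assms that by (simp add: linear_scale exp_add[symmetric] mult_ac)
    from this[of "real _" "b / Suc n" "b / Suc n"] show ?thesis
      using assms unfolding uniform_sum_def linear_sum[OF la[OF less_imp_le[OF assms(2)]]] scaleR_sum_right
      by (intro sum.cong) (simp_all only: add_0_left, simp)
  qed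
  have "(\<lambda>n. uniform_sum ?g 0 a n + exp (- a) *\<^sub>R T a (uniform_sum ?g 0 b n))
      \<longlonglongrightarrow> F a + exp (- a) *\<^sub>R T a (F b)"
    using assms
    by (intro tendsto_add tendsto_scaleR_tvs tendsto_const sequentially_continuous uniform_sum_tendsto) auto
  then have "(\<lambda>n. uniform_sum ?g 0 a n + uniform_sum ?g a b n) \<longlonglongrightarrow> F a + exp (- a) *\<^sub>R T a (F b)"
    by (simp only: shift)
  moreover have "(\<lambda>n. uniform_sum ?g 0 a n + uniform_sum ?g a b n) \<longlonglongrightarrow> F (a + b)"
    using assms by (intro split_uniform_sum_tendsto) auto
  ultimately show ?thesis by (rule LIMSEQ_unique[symmetric])
qed

lemma discounted_integral_mean_tendsto:
  assumes int: "\<And>r. r \<ge> 0 \<Longrightarrow> has_riemann_integral (\<lambda>t. exp (- t) *\<^sub>R T t x) (F r) 0 r"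
  shows "((\<lambda>h. F h /\<^sub>R h) \<longlongrightarrow> x) (at_right 0)"
proof -
  have "((\<lambda>t. exp (- t)) \<longlongrightarrow> exp (- 0 :: real)) (at_right 0)"
    by (intro tendsto_intros)
  then have "((\<lambda>t. exp (- t) *\<^sub>R T t x) \<longlongrightarrow> exp (- 0) *\<^sub>R T 0 x) (at_right 0)"
    using right_continuous by (intro tendsto_scaleR_tvs) (auto simp: zero)
  from riemann_integral_mean_tendsto[OF this int] show ?thesis by (simp add: zero)
qed

text \<open>
  Cutting the integral over \<open>{0..a + h}\<close> at \<open>a\<close> and at \<open>h\<close> expresses the increment of
  \<open>exp (- h) *\<^sub>R T h\<close> at \<open>F a\<close> through \<open>F h\<close>, whose mean converges. The factor \<open>exp (- h)\<close> contributes
  the additional term with \<open>(exp h - 1) / h\<close>.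
\<close>

lemma discounted_integral_in_generator_domain:
  assumes int: "\<And>r. r \<ge> 0 \<Longrightarrow> has_riemann_integral (\<lambda>t. exp (- t) *\<^sub>R T t x) (F r) 0 r"
    and a: "a > 0"
  shows "F a \<in> generator_domain T"
proof -
  have exp_lim: "((\<lambda>h. exp h) \<longlongrightarrow> 1) (at_right (0::real))"
    using tendsto_exp[OF tendsto_ident_at, of 0 "{0<..}"] by simp
  have exp_deriv: "((\<lambda>h. (exp h - 1) / h) \<longlongrightarrow> 1) (at_right (0::real))"
    using DERIV_exp[of "0::real"] unfolding DERIV_def
    by (auto intro: tendsto_mono[OF at_le])
  note mean = discounted_integral_mean_tendsto[OF int]
  have quotient: "(T h (F a) - F a) /\<^sub>R h
      = ((exp h - 1) / h) *\<^sub>R F a + exp h *\<^sub>R (exp (- a) *\<^sub>R T a (F h /\<^sub>R h) - F h /\<^sub>R h)"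
    if h: "h > 0" for h
  proof -
    have "F h + exp (- h) *\<^sub>R T h (F a) = F a + exp (- a) *\<^sub>R T a (F h)"
      using discounted_integral_add[OF int a h] discounted_integral_add[OF int h a]
      by (simp add: add.commute)
    then have "exp (- h) *\<^sub>R T h (F a) = F a + exp (- a) *\<^sub>R T a (F h) - F h"
      by (simp add: algebra_simps)
    then have "exp h *\<^sub>R (exp (- h) *\<^sub>R T h (F a)) = exp h *\<^sub>R (F a + exp (- a) *\<^sub>R T a (F h) - F h)"
      by (rule arg_cong)
    then have "T h (F a) = exp h *\<^sub>R (F a + exp (- a) *\<^sub>R T a (F h) - F h)"
      by (simp add: exp_minus)
    then show ?thesis
      unfolding \<open>T h (F a) = _\<close> using linear[of a] a
      by (simp add: linear_scale diff_divide_distrib divide_inverse algebra_simps)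
  qed
  have "((\<lambda>h. ((exp h - 1) / h) *\<^sub>R F a + exp h *\<^sub>R (exp (- a) *\<^sub>R T a (F h /\<^sub>R h) - F h /\<^sub>R h))
      \<longlongrightarrow> 1 *\<^sub>R F a + 1 *\<^sub>R (exp (- a) *\<^sub>R T a x - x)) (at_right 0)"
    using a
    by (intro tendsto_add tendsto_diff tendsto_scaleR_tvs tendsto_const exp_lim exp_deriv mean tendsto_operator) auto
  then have "((\<lambda>h. (T h (F a) - F a) /\<^sub>R h)
      \<longlongrightarrow> 1 *\<^sub>R F a + 1 *\<^sub>R (exp (- a) *\<^sub>R T a x - x)) (at_right 0)"
    by (rule Lim_transform_within[where d=1]) (use quotient in auto)
  then show ?thesis by (auto simp: generator_domain_def)
qed

end

theorem theorem3p25: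
  fixes T S :: "real \<Rightarrow> 'a::hausdorff_locally_convex_space \<Rightarrow> 'a"
    and A :: "'a \<rightharpoonup> 'a"
  assumes "C0_sequentially_equicontinuous_semigroup T"
    and "infinitesimal_generator T = A"
    and "\<And>x l. l > 0 \<Longrightarrow> generalized_riemann_integrable (\<lambda>t. exp (- l * t) *\<^sub>R T t x)"
    and "C0_sequentially_equicontinuous_semigroup S"
    and "infinitesimal_generator S = A"
  shows "\<forall>t\<ge>0. S t = T t"
proof (intro allI impI ext)
  fix t :: real and x :: 'a
  assume t: "t \<ge> 0"
  interpret T: C0_sequentially_equicontinuous_semigroup T by fact
  interpret S: C0_sequentially_equicontinuous_semigroup S by fact
  show "S t x = T t x"
  proof (cases "t = 0")
    case True
    then show ?thesis by (simp add: S.zero T.zero)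
  next
    case False
    obtain F where F: "\<And>r. r \<ge> 0 \<Longrightarrow> has_riemann_integral (\<lambda>t. exp (- t) *\<^sub>R T t x) (F r) 0 r"
      using assms(3)[of 1 x] by (auto simp: generalized_riemann_integrable_def)
    define X where "X n = F (inverse (Suc n)) /\<^sub>R inverse (Suc n)" for n
    have "filterlim (\<lambda>n. inverse (real (Suc n))) (at_right 0) sequentially"
      using LIMSEQ_inverse_real_of_nat
      by (intro tendsto_imp_filterlim_at_right) (auto simp: eventually_sequentially)
    then have X: "X \<longlonglongrightarrow> x"
      unfolding X_def using T.discounted_integral_mean_tendsto[OF F] by (rule filterlim_compose[rotated])
    have "S t (X n) = T t (X n)" for n
    proof -
      have "S t (F (inverse (Suc n))) = T t (F (inverse (Suc n)))"
        using t False assms(1,2,4,5) T.discounted_integral_in_generator_domain[OF F]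
        by (intro semigroups_agree_on_domain) auto
      then show ?thesis using t S.linear T.linear by (simp add: X_def linear_scale del: of_nat_Suc)
    qed
    then show ?thesis
      using T.sequentially_continuous[OF X t] S.sequentially_continuous[OF X t] LIMSEQ_unique by simp
  qed
qed

end
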